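(* Let $f\in\Gamma_0(\mathcal H)$ have non-empty set of minimizers and minimum value $f^*$. Let $\{x_k\}$, $\{\tilde x_{k+1}\}$, $\{z_k\}$ be generated from $z_0=x_0\in\mathcal H$ by the Symplectic Proximal Point Algorithm: for $k=0,1,\dots$, $$\tilde x_{k+1}=\frac{1}{b_k+1}z_k+\frac{b_k}{b_k+1}x_k,\qquad x_{k+1}=\mathop{\mathrm{argmin}}_{x\in\mathcal H}\Big\{f(x)+\frac{b_k+1}{2c_k}\|x-\tilde x_{k+1}\|_L^2\Big\},\qquad z_{k+1}=z_k+\frac{a_k(b_k+1)}{c_k}(x_{k+1}-\tilde x_{k+1}).$$ Suppose that: (i) $A_k=a_kb_k$ for all $k\ge0$; (ii) there exists a constant $d\in(0,1)$ such that $0\le A_{k+1}-A_k\le d\,a_k$ for all $k\ge0$; (iii) $\sup_{k\ge1}\dfrac{c_{k+1}-c_k}{a_k}<\infty$; (iv) the limit $\beta:=\lim_{k\to\infty}\dfrac{k}{b_k}$ exists and lies in $(1,\infty)$; (v) there exist two positive constants $\gamma_1>0.5$ and $\gamma_2$, and an integer $K$, such that $\gamma_1a_k\le c_k\le\gamma_2a_k$ for all $k\ge K$. Then $$\lim_{k\to\infty}A_k[f(x_k)-f^*]=0 .$$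
   Context: $\mathcal H$ is a real Hilbert space with inner product $\langle\cdot,\cdot\rangle$ and norm $\|\cdot\|$. $\Gamma_0(\mathcal H)$ is the set of closed, proper, convex (extended-real-valued) functions on $\mathcal H$. $L:\mathcal H\to\mathcal H$ is a positive definite operator (bounded, linear, self-adjoint, with inverse $L^{-1}$ defined on $\mathcal H$); $\|x\|_L=\sqrt{\langle Lx,x\rangle}$. The real sequences $\{a_k\},\{b_k\},\{c_k\}$ are positive for $k\ge1$ and non-negative for $k=0$ (with $c_0>0$, since the algorithm divides by $c_k$). *)

theory Defs
  imports "HOL-Analysis.Analysis"
begin

definition ereal_epigraph :: "('a \<Rightarrow> ereal) \<Rightarrow> ('a \<times> real) set" where
  "ereal_epigraph f = {(x, r). f x \<le> ereal r}"

text \<open>Closedness and convexity of an extended-real-valued function are those of its epigraph.\<close>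

definition Gamma_0 :: "('a::real_normed_vector \<Rightarrow> ereal) set" where
  "Gamma_0 = {f. closed (ereal_epigraph f) \<and> convex (ereal_epigraph f) \<and>
     (\<forall>x. f x \<noteq> -\<infinity>) \<and> (\<exists>x. f x \<noteq> \<infinity>)}"

text \<open>The inverse is only required to exist on the whole space; on a Hilbert space it is then
  automatically bounded.\<close>

definition positive_definite_operator :: "('a::real_inner \<Rightarrow> 'a) \<Rightarrow> bool" where
  "positive_definite_operator L \<longleftrightarrow>
     bounded_linear L \<and> (\<forall>x y. inner (L x) y = inner x (L y)) \<and>
     (\<forall>x. x \<noteq> 0 \<longrightarrow> inner (L x) x > 0) \<and> bij L"

definition weighted_norm :: "('a::real_inner \<Rightarrow> 'a) \<Rightarrow> 'a \<Rightarrow> real" where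
  "weighted_norm L x = sqrt (inner (L x) x)"

definition minimizers :: "('a \<Rightarrow> ereal) \<Rightarrow> 'a set" where
  "minimizers f = {x. is_arg_min f (\<lambda>_. True) x}"

text \<open>The sequence \<open>xt\<close> is indexed so that \<open>xt (Suc k)\<close> is the extrapolated point from which
  \<open>x (Suc k)\<close> is computed; \<open>xt 0\<close> is unconstrained.  For \<open>f\<close> in \<^const>\<open>Gamma_0\<close>, \<open>c k > 0\<close>
  and \<open>b k \<ge> 0\<close>, the objective minimized by \<open>x (Suc k)\<close> is strictly convex,
  so being a minimizer determines \<open>x (Suc k)\<close>.\<close>

definition symplectic_proximal_point ::
  "('a::real_inner \<Rightarrow> ereal) \<Rightarrow> ('a \<Rightarrow> 'a) \<Rightarrow> (nat \<Rightarrow> real) \<Rightarrow> (nat \<Rightarrow> real) \<Rightarrow> (nat \<Rightarrow> real) \<Rightarrow>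
   (nat \<Rightarrow> 'a) \<Rightarrow> (nat \<Rightarrow> 'a) \<Rightarrow> (nat \<Rightarrow> 'a) \<Rightarrow> bool" where
  "symplectic_proximal_point f L a b c x xt z \<longleftrightarrow>
     z 0 = x 0 \<and>
     (\<forall>k. xt (Suc k) = (1 / (b k + 1)) *\<^sub>R z k + (b k / (b k + 1)) *\<^sub>R x k \<and>
          x (Suc k) \<in> minimizers
            (\<lambda>y. f y + ereal ((b k + 1) / (2 * c k) * (weighted_norm L (y - xt (Suc k)))\<^sup>2)) \<and>
          z (Suc k) = z k + (a k * (b k + 1) / c k) *\<^sub>R (x (Suc k) - xt (Suc k)))"

end

theory Submission
  imports Defs
begin

text \<open>
  The proximal step has the optimality condition that, with
  \<open>v\<^sub>k = (b\<^sub>k + 1) / c\<^sub>k (xt\<^sub>k\<^sub>+\<^sub>1 - x\<^sub>k\<^sub>+\<^sub>1)\<close>, the vector \<open>L v\<^sub>k\<close> is a subgradient of \<open>f\<close> at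
  \<open>x\<^sub>k\<^sub>+\<^sub>1\<close>. In terms of \<open>v\<close> the algorithm reads
  \<open>z\<^sub>k = x\<^sub>k\<^sub>+\<^sub>1 + b\<^sub>k (x\<^sub>k\<^sub>+\<^sub>1 - x\<^sub>k) + c\<^sub>k v\<^sub>k\<close> and \<open>z\<^sub>k\<^sub>+\<^sub>1 = z\<^sub>k - a\<^sub>k v\<^sub>k\<close>. Write \<open>F\<^sub>k\<close> for the
  gap \<open>f x\<^sub>k - f*\<close> and measure all vectors in the norm of \<open>L\<close>. Two energies are used.

  The first one, \<open>A\<^sub>k F\<^sub>k + |z\<^sub>k - p|\<^sup>2 / 2\<close> for a minimizer \<open>p\<close>, is anchored at the solution
  (lemma \<open>anchored_energy_step\<close>). It decreases from \<open>K\<close> on, and because \<open>d < 1\<close> and \<open>\<gamma>\<^sub>1 > 1/2\<close> its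
  decrease leaves the finite sums \<open>\<Sum> a\<^sub>k F\<^sub>k\<^sub>+\<^sub>1\<close> and \<open>\<Sum> a\<^sub>k\<^sup>2 |v\<^sub>k|\<^sup>2\<close>. This only bounds
  \<open>A\<^sub>k F\<^sub>k\<close>, since the anchored term need not vanish.

  The second one, \<open>G\<^sub>k = (A\<^sub>k + c\<^sub>k) F\<^sub>k + |z\<^sub>k - x\<^sub>k|\<^sup>2 / 2\<close>, replaces the anchor by the current
  iterate (lemma \<open>momentum_energy_step\<close>). It grows by at most a constant times \<open>a\<^sub>k F\<^sub>k\<^sub>+\<^sub>1\<close>,
  because \<open>A\<close> and \<open>c\<close> both have increments at most of order \<open>a\<^sub>k\<close>, and this is summable. Hence
  \<open>G\<close> converges, and the dissipated terms give \<open>\<Sum> b\<^sub>k |x\<^sub>k\<^sub>+\<^sub>1 - x\<^sub>k|\<^sup>2 < \<infinity>\<close>.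

  Both parts of \<open>G\<^sub>k\<^sub>+\<^sub>1 / b\<^sub>k\<close> are then summable: for the gap since \<open>A\<^sub>k / b\<^sub>k = a\<^sub>k\<close>, for the
  momentum since \<open>z\<^sub>k\<^sub>+\<^sub>1 - x\<^sub>k\<^sub>+\<^sub>1 = b\<^sub>k (x\<^sub>k\<^sub>+\<^sub>1 - x\<^sub>k) + (c\<^sub>k - a\<^sub>k) v\<^sub>k\<close>. As \<open>b\<^sub>k\<close> grows
  linearly, \<open>\<Sum> 1 / b\<^sub>k\<close> diverges like the harmonic series, so the limit of \<open>G\<close> can only be \<open>0\<close>,
  and \<open>0 \<le> A\<^sub>k F\<^sub>k \<le> G\<^sub>k\<close>.
\<close>

section \<open>Real sequences\<close>

text \<open>Subtracting the partial sums of the perturbation turns \<open>e\<close> into a decreasing sequence that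
  is bounded below, and telescoping bounds the total amount \<open>w\<close> dissipated.\<close>

lemma perturbed_descent:
  fixes e w p :: "nat \<Rightarrow> real"
  assumes e: "\<And>n. 0 \<le> e n" and w: "\<And>n. 0 \<le> w n" and p: "\<And>n. 0 \<le> p n"
    and sp: "summable p" and step: "\<And>n. e (Suc n) + w n \<le> e n + p n"
  shows "summable w" and "convergent e"
proof -
  define P where "P n = (\<Sum>i<n. p i)" for n
  have P_le: "P n \<le> suminf p" for n
    unfolding P_def using sp p by (intro sum_le_suminf) auto
  have tele: "e n + (\<Sum>i<n. w i) \<le> e 0 + P n" for n
  proof (induction n)
    case (Suc n)
    then show ?case using step[of n] by (simp add: P_def)
  qed (simp add: P_def)
  have w_le: "(\<Sum>i<n. w i) \<le> e 0 + suminf p" for n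
    using tele[of n] P_le[of n] e[of n] by linarith
  show "summable w"
    by (rule summableI_nonneg_bounded[OF w w_le])
  have "decseq (\<lambda>n. e n - P n)"
    by (rule decseq_SucI) (use step w in \<open>simp add: P_def, smt (verit)\<close>)
  moreover have "- suminf p \<le> e n - P n" for n
    using P_le[of n] e[of n] by linarith
  ultimately have "convergent (\<lambda>n. e n - P n)"
    using decseq_convergent[of "\<lambda>n. e n - P n" "- suminf p"] convergentI by blast
  moreover have "convergent P"
    unfolding P_def using sp by (simp add: summable_iff_convergent)
  ultimately have "convergent (\<lambda>n. (e n - P n) + P n)"
    by (rule convergent_add)
  then show "convergent e" by simp
qed

text \<open>With a positive limit of \<open>g\<close>, summability of the weighted terms would carry over to the
  weights. The shift in \<open>g\<close> matches the energy estimate, which controls the next iterate.\<close>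

lemma convergent_summable_weight_tendsto_zero:
  fixes g w :: "nat \<Rightarrow> real"
  assumes g: "convergent g" and g0: "\<And>n. 0 \<le> g n" and w: "\<And>n. 0 \<le> w n"
    and nw: "\<not> summable w" and s: "summable (\<lambda>k. g (Suc k) * w k)"
  shows "g \<longlonglongrightarrow> 0"
proof (rule ccontr)
  obtain l where l: "g \<longlonglongrightarrow> l" using g by (auto simp: convergent_def)
  assume "\<not> ?thesis"
  then have "l \<noteq> 0" using l by auto
  moreover have "0 \<le> l" using l g0 by (intro LIMSEQ_le_const) auto
  ultimately have l0: "0 < l" by simp
  then have "\<forall>\<^sub>F k in sequentially. l / 2 < g (Suc k)"
    using l by (intro order_tendstoD(1)[where y = l]) (auto simp: filterlim_sequentially_Suc)
  then have "\<forall>\<^sub>F k in sequentially. norm (l / 2 * w k) \<le> g (Suc k) * w k"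
  proof eventually_elim
    case (elim k)
    then have "l / 2 * w k \<le> g (Suc k) * w k" using w[of k] by (intro mult_right_mono) auto
    then show ?case using w[of k] l0 by (simp add: abs_mult)
  qed
  then have "summable (\<lambda>k. l / 2 * w k)"
    using s by (rule summable_comparison_test_ev)
  then show False using l0 nw by (simp add: summable_cmult_iff)
qed

lemma linear_growth_ge_one:
  fixes b :: "nat \<Rightarrow> real"
  assumes pos: "\<And>k. 1 \<le> k \<Longrightarrow> 0 < b k" and lim: "(\<lambda>k. real k / b k) \<longlonglongrightarrow> \<beta>"
  shows "\<forall>\<^sub>F k in sequentially. 1 \<le> b k"
proof -
  define B where "B = \<bar>\<beta>\<bar> + 1"
  have "\<forall>\<^sub>F k in sequentially. real k / b k < B"
    using lim by (intro order_tendstoD(2)[OF lim]) (simp add: B_def)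
  then show ?thesis
    using eventually_ge_at_top[of "max 1 (nat \<lceil>B\<rceil>)"]
  proof eventually_elim
    case (elim k)
    then have "0 < b k" "B \<le> real k" using pos[of k] by linarith+
    with elim have "B * 1 < B * b k" by (simp add: divide_less_eq)
    then show ?case by (subst (asm) mult_less_cancel_left_pos) (auto simp: B_def)
  qed
qed

lemma linear_growth_not_summable_inverse:
  fixes b :: "nat \<Rightarrow> real"
  assumes lim: "(\<lambda>k. real k / b k) \<longlonglongrightarrow> \<beta>" and \<beta>: "0 < \<beta>"
  shows "\<not> summable (\<lambda>k. 1 / b k)"
proof
  assume s: "summable (\<lambda>k. 1 / b k)"
  have "\<forall>\<^sub>F k in sequentially. \<beta> / 2 < real k / b k"
    using \<beta> by (intro order_tendstoD(1)[OF lim]) auto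
  then have "\<forall>\<^sub>F k in sequentially. norm (\<beta> / 2 * inverse (real k)) \<le> 1 / b k"
    using eventually_gt_at_top[of 0]
  proof eventually_elim
    case (elim k)
    then have "\<beta> / 2 * inverse (real k) \<le> (real k / b k) * inverse (real k)"
      by (intro mult_right_mono) auto
    also have "\<dots> = 1 / b k" using elim by simp
    finally show ?case using \<beta> by (simp add: abs_mult)
  qed
  then have "summable (\<lambda>k. \<beta> / 2 * inverse (real k))"
    using s by (rule summable_comparison_test_ev)
  then have "summable (\<lambda>k. inverse (real k))"
    using \<beta> by (subst (asm) summable_cmult_iff) auto
  then show False using not_summable_harmonic[where 'a = real] by simp
qed

section \<open>The quadratic form of the operator\<close>

lemma weighted_norm_square:
  assumes "positive_definite_operator L"
  shows "(weighted_norm L x)\<^sup>2 = inner (L x) x"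
  using assms unfolding weighted_norm_def positive_definite_operator_def
  by (cases "x = 0") (auto simp: less_imp_le)

lemma positive_definite_operator_simps:
  assumes "positive_definite_operator L"
  shows "L (x + y) = L x + L y" "L (x - y) = L x - L y" "L (r *\<^sub>R x) = r *\<^sub>R L x"
    and "inner (L x) y = inner (L y) x" and "0 \<le> inner (L x) x"
proof -
  interpret bounded_linear L using assms by (simp add: positive_definite_operator_def)
  show "L (x + y) = L x + L y" "L (x - y) = L x - L y" "L (r *\<^sub>R x) = r *\<^sub>R L x"
    by (simp_all add: add diff scaleR)
  show "inner (L x) y = inner (L y) x"
    using assms by (metis positive_definite_operator_def inner_commute)
  show "0 \<le> inner (L x) x"
    using weighted_norm_square[OF assms, of x] by (metis zero_le_power2)
qed

lemma quadratic_form_add: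
  assumes L: "positive_definite_operator L"
  shows "inner (L (x + y)) (x + y) = inner (L x) x + 2 * inner (L x) y + inner (L y) y"
  using positive_definite_operator_simps(4)[OF L, of y x]
  by (simp add: positive_definite_operator_simps(1)[OF L] inner_simps)

lemma quadratic_form_diff:
  assumes L: "positive_definite_operator L"
  shows "inner (L (x - y)) (x - y) = inner (L x) x - 2 * inner (L y) x + inner (L y) y"
  using positive_definite_operator_simps(4)[OF L, of y x]
  by (simp add: positive_definite_operator_simps(2)[OF L] inner_simps)

lemma quadratic_form_add_le:
  assumes L: "positive_definite_operator L"
  shows "inner (L (x + y)) (x + y) \<le> 2 * inner (L x) x + 2 * inner (L y) y"
  using quadratic_form_add[OF L, of x y] quadratic_form_diff[OF L, of x y]
    positive_definite_operator_simps(4)[OF L, of x y]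
    positive_definite_operator_simps(5)[OF L, of "x - y"]
  by linarith

section \<open>The optimality condition of the proximal step\<close>

lemma minimizers_iff:
  fixes f :: "'a \<Rightarrow> ereal"
  shows "p \<in> minimizers f \<longleftrightarrow> (\<forall>y. f p \<le> f y)"
  by (auto simp: minimizers_def is_arg_min_def not_less)

lemma Gamma_0_convex:
  assumes f: "f \<in> Gamma_0" and x: "f x = ereal r" and y: "f y = ereal s"
    and t: "0 \<le> t" "t \<le> 1"
  shows "f (x + t *\<^sub>R (y - x)) \<le> ereal (r + t * (s - r))"
proof -
  have "(1 - t) *\<^sub>R (x, r) + t *\<^sub>R (y, s) \<in> ereal_epigraph f"
    using f x y t unfolding Gamma_0_def
    by (intro convexD_alt) (auto simp: ereal_epigraph_def)
  then show ?thesis by (simp add: ereal_epigraph_def algebra_simps)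
qed

text \<open>Compare \<open>x\<close> with the points \<open>x + t (y - x)\<close>: convexity bounds the change of \<open>f\<close> by a multiple
  of \<open>t\<close>, and the quadratic penalty contributes its linear part plus a term of order \<open>t\<^sup>2\<close>.
  Dividing by \<open>t\<close> and letting \<open>t\<close> tend to \<open>0\<close> leaves the subgradient inequality.\<close>

lemma prox_subgradient:
  fixes f :: "'a::real_inner \<Rightarrow> ereal"
  assumes f: "f \<in> Gamma_0" and L: "positive_definite_operator L" and q: "0 \<le> q"
    and min: "x \<in> minimizers (\<lambda>y. f y + ereal (q / 2 * (weighted_norm L (y - w))\<^sup>2))"
    and x: "f x = ereal r" and y: "f y = ereal s"
  shows "r - s \<le> inner (L (q *\<^sub>R (w - x))) (x - y)"
proof -
  let ?q = "\<lambda>h. inner (L h) h"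
  define m where "m = inner (L (y - x)) (x - w)"
  have le: "0 \<le> (s - r) + q * m + t * (q / 2 * ?q (y - x))" if t: "0 < t" "t \<le> 1" for t
  proof -
    have "ereal (r + q / 2 * ?q (x - w))
      \<le> f (x + t *\<^sub>R (y - x)) + ereal (q / 2 * ?q (x + t *\<^sub>R (y - x) - w))"
      using min x by (simp add: minimizers_iff weighted_norm_square[OF L])
    also have "\<dots> \<le> ereal (r + t * (s - r)) + ereal (q / 2 * ?q (x + t *\<^sub>R (y - x) - w))"
      using Gamma_0_convex[OF f x y, of t] t by (intro add_right_mono) auto
    also have "x + t *\<^sub>R (y - x) - w = (x - w) + t *\<^sub>R (y - x)" by simp
    also have "?q ((x - w) + t *\<^sub>R (y - x)) = ?q (x - w) + 2 * t * m + t * t * ?q (y - x)"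
      unfolding m_def quadratic_form_add[OF L]
      using positive_definite_operator_simps(4)[OF L, of "x - w" "y - x"]
      by (simp add: positive_definite_operator_simps(3)[OF L])
    finally have "0 \<le> t * ((s - r) + q * m + t * (q / 2 * ?q (y - x)))"
      by (simp add: algebra_simps)
    then show ?thesis using t by (simp add: zero_le_mult_iff)
  qed
  have "((\<lambda>t. (s - r) + q * m + t * (q / 2 * ?q (y - x)))
      \<longlongrightarrow> (s - r) + q * m + 0 * (q / 2 * ?q (y - x))) (at_right 0)"
    by (intro tendsto_intros)
  moreover have "\<forall>\<^sub>F t in at_right 0. 0 \<le> (s - r) + q * m + t * (q / 2 * ?q (y - x))"
    unfolding eventually_at_right_field using le by (intro exI[of _ 1]) auto
  ultimately have "0 \<le> (s - r) + q * m + 0 * (q / 2 * ?q (y - x))"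
    by (rule tendsto_lowerbound) simp
  moreover have "inner (L (q *\<^sub>R (w - x))) (x - y) = q * m"
  proof -
    have "inner (L (q *\<^sub>R (w - x))) (x - y) = q * inner (L (x - w)) (y - x)"
      by (simp add: positive_definite_operator_simps(2,3)[OF L] inner_simps algebra_simps)
    then show ?thesis
      unfolding m_def using positive_definite_operator_simps(4)[OF L, of "y - x" "x - w"] by simp
  qed
  ultimately show ?thesis by simp
qed

lemma prox_point_finite:
  assumes f: "f \<in> Gamma_0" and min: "x \<in> minimizers (\<lambda>y. f y + ereal (h y))"
  shows "\<bar>f x\<bar> \<noteq> \<infinity>"
proof -
  obtain y where "f y \<noteq> \<infinity>" using f by (auto simp: Gamma_0_def)
  moreover have "f x + ereal (h x) \<le> f y + ereal (h y)" using min by (simp add: minimizers_iff)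
  ultimately have "f x \<noteq> \<infinity>" by auto
  moreover have "f x \<noteq> -\<infinity>" using f by (simp add: Gamma_0_def)
  ultimately show ?thesis by auto
qed

section \<open>Two energies\<close>

text \<open>Expanding the square, the change of the distance to \<open>p\<close> has the linear part
  \<open>- a \<langle>L v, z - p\<rangle>\<close>. Inserting \<open>z\<close> splits it into \<open>\<langle>L v, x' - p\<rangle>\<close>, which pays for \<open>a F'\<close>,
  and \<open>b \<langle>L v, x' - x\<rangle>\<close>, which pays for the change of the gap with weight \<open>a b\<close>; this is
  why the coefficient of the gap has to be \<open>a b\<close>.\<close>

lemma anchored_energy_step:
  assumes L: "positive_definite_operator L"
    and z: "z = x' + b *\<^sub>R (x' - x) + c *\<^sub>R v"
    and sub_p: "F' \<le> inner (L v) (x' - p)" and sub_x: "F' - F \<le> inner (L v) (x' - x)"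
    and a: "0 \<le> a" and b: "0 \<le> b"
  shows "a * b * F' + inner (L (z - a *\<^sub>R v - p)) (z - a *\<^sub>R v - p) / 2
      + a * F' + a * (c - a / 2) * inner (L v) v
    \<le> a * b * F + inner (L (z - p)) (z - p) / 2"
proof -
  define Sp Sx where "Sp = inner (L v) (x' - p)" and "Sx = inner (L v) (x' - x)"
  define Q Q' Qv where "Q = inner (L (z - p)) (z - p)"
    and "Q' = inner (L (z - a *\<^sub>R v - p)) (z - a *\<^sub>R v - p)" and "Qv = inner (L v) v"
  have "inner (L v) (z - p) = Sp + b * Sx + c * Qv"
    by (simp add: z Sp_def Sx_def Qv_def inner_simps algebra_simps)
  moreover have "z - a *\<^sub>R v - p = (z - p) - a *\<^sub>R v" by simp
  ultimately have "Q' = Q - 2 * a * (Sp + b * Sx + c * Qv) + a * a * Qv"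
    unfolding Q_def Q'_def Qv_def
    by (simp only: quadratic_form_diff[OF L]) (simp add: positive_definite_operator_simps(3)[OF L])
  moreover have "a * F' \<le> a * Sp"
    using sub_p a unfolding Sp_def by (rule mult_left_mono)
  moreover have "a * b * (F' - F) \<le> a * b * Sx"
    using sub_x a b unfolding Sx_def by (intro mult_left_mono) auto
  ultimately have "a * b * F' + Q' / 2 + a * F' + a * (c - a / 2) * Qv \<le> a * b * F + Q / 2"
    by (simp add: algebra_simps)
  then show ?thesis unfolding Q_def Q'_def Qv_def .
qed

text \<open>Here the point subtracted from \<open>z\<close> moves along with the iterates, so that the change of the
  square also contains \<open>D = x' - x\<close>. Since \<open>z - x = (b + 1) D + c v\<close>, expanding it produces
  \<open>\<langle>L v, D\<rangle>\<close> with total coefficient \<open>- (a b + c)\<close>, which fixes the weight of the gap, and the new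
  dissipation \<open>(b + 1/2) \<langle>L D, D\<rangle>\<close>.\<close>

lemma momentum_energy_step:
  assumes L: "positive_definite_operator L"
    and z: "z = x' + b *\<^sub>R (x' - x) + c *\<^sub>R v"
    and sub_x: "F' - F \<le> inner (L v) (x' - x)"
    and ab: "0 \<le> a * b + c"
  shows "(a * b + c) * F' + inner (L (z - a *\<^sub>R v - x')) (z - a *\<^sub>R v - x') / 2
      + a * (c - a / 2) * inner (L v) v + (b + 1 / 2) * inner (L (x' - x)) (x' - x)
    \<le> (a * b + c) * F + inner (L (z - x)) (z - x) / 2"
proof -
  define D where "D = x' - x"
  define Q Q' where "Q = inner (L (z - x)) (z - x)"
    and "Q' = inner (L (z - a *\<^sub>R v - x')) (z - a *\<^sub>R v - x')"
  define Qv QD S where "Qv = inner (L v) v" and "QD = inner (L D) D" and "S = inner (L v) D"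
  have u: "z - x = (b + 1) *\<^sub>R D + c *\<^sub>R v" by (simp add: z D_def algebra_simps)
  have u': "z - a *\<^sub>R v - x' = (z - x) - (a *\<^sub>R v + D)" by (simp add: D_def)
  have sym: "inner (L D) v = S"
    unfolding S_def by (rule positive_definite_operator_simps(4)[OF L])
  have "inner (L (a *\<^sub>R v + D)) (z - x) = (a * (b + 1) + c) * S + a * c * Qv + (b + 1) * QD"
    unfolding u
    by (simp add: positive_definite_operator_simps(1,3)[OF L] inner_simps sym algebra_simps
        flip: Qv_def QD_def S_def)
  moreover have "inner (L (a *\<^sub>R v + D)) (a *\<^sub>R v + D) = a * a * Qv + 2 * a * S + QD"
    unfolding quadratic_form_add[OF L] Qv_def QD_def S_def
    by (simp add: positive_definite_operator_simps(3)[OF L])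
  ultimately have "Q' = Q - 2 * ((a * (b + 1) + c) * S + a * c * Qv + (b + 1) * QD)
      + (a * a * Qv + 2 * a * S + QD)"
    unfolding Q_def Q'_def u' quadratic_form_diff[OF L] by (simp only:)
  moreover have "(a * b + c) * (F' - F) \<le> (a * b + c) * S"
    using sub_x ab unfolding S_def D_def by (intro mult_left_mono) auto
  ultimately have "(a * b + c) * F' + Q' / 2 + a * (c - a / 2) * Qv + (b + 1 / 2) * QD
      \<le> (a * b + c) * F + Q / 2"
    by (simp add: algebra_simps)
  then show ?thesis unfolding Q_def Q'_def Qv_def QD_def D_def .
qed

section \<open>Convergence\<close>

text \<open>The convergence argument itself, for the recursion in terms of subgradients. Here \<open>F\<close> is an
  arbitrary nonnegative sequence obeying the two subgradient inequalities, and the growth of \<open>b\<close>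
  enters through the divergence of \<open>\<Sum> 1 / b k\<close>, which is unaffected by dropping initial
  terms.\<close>

lemma symplectic_gap_tendsto_zero:
  fixes L :: "'a::real_inner \<Rightarrow> 'a" and x z v :: "nat \<Rightarrow> 'a" and a b c F :: "nat \<Rightarrow> real"
  assumes L: "positive_definite_operator L"
    and z: "\<And>k. z k = x (Suc k) + b k *\<^sub>R (x (Suc k) - x k) + c k *\<^sub>R v k"
    and z_Suc: "\<And>k. z (Suc k) = z k - a k *\<^sub>R v k"
    and sub_p: "\<And>k. F (Suc k) \<le> inner (L (v k)) (x (Suc k) - p)"
    and sub_x: "\<And>k. F (Suc k) - F k \<le> inner (L (v k)) (x (Suc k) - x k)"
    and F: "\<And>k. 0 \<le> F k" and a: "\<And>k. 0 \<le> a k" and b: "\<And>k. 1 \<le> b k"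
    and nb: "\<not> summable (\<lambda>k. 1 / b k)"
    and A: "\<And>k. a (Suc k) * b (Suc k) \<le> a k * b k + d * a k" and d: "0 \<le> d" "d < 1"
    and c: "\<And>k. c (Suc k) \<le> c k + M * a k" and M: "0 \<le> M"
    and \<gamma>\<^sub>1: "\<And>k. \<gamma>\<^sub>1 * a k \<le> c k" "\<gamma>\<^sub>1 > 1 / 2"
    and \<gamma>\<^sub>2: "\<And>k. c k \<le> \<gamma>\<^sub>2 * a k" "\<gamma>\<^sub>2 > 0"
  shows "(\<lambda>k. a k * b k * F k) \<longlonglongrightarrow> 0"
proof -
  let ?q = "\<lambda>h. inner (L h) h"
  define V where "V k = (a k)\<^sup>2 * ?q (v k)" for k
  define D where "D k = ?q (x (Suc k) - x k)" for k
  have q0: "0 \<le> ?q h" for h by (rule positive_definite_operator_simps(5)[OF L])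
  have b0: "0 \<le> b k" for k using b[of k] by linarith
  have c0: "0 \<le> c k" for k
    using \<gamma>\<^sub>1(1)[of k] mult_nonneg_nonneg[of \<gamma>\<^sub>1 "a k"] a[of k] \<gamma>\<^sub>1(2) by linarith
  have V0: "0 \<le> V k" for k by (simp add: V_def q0)
  have dissipation: "(\<gamma>\<^sub>1 - 1 / 2) * V k \<le> a k * (c k - a k / 2) * ?q (v k)" for k
  proof -
    have "(\<gamma>\<^sub>1 - 1 / 2) * a k \<le> c k - a k / 2"
      using \<gamma>\<^sub>1(1)[of k] by (simp add: algebra_simps)
    then have "(a k * ?q (v k)) * ((\<gamma>\<^sub>1 - 1 / 2) * a k) \<le> (a k * ?q (v k)) * (c k - a k / 2)"
      by (rule mult_left_mono) (simp add: a q0)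
    then show ?thesis by (simp add: V_def power2_eq_square mult_ac)
  qed

  \<comment> \<open>The anchored energy: \<open>a F\<close> and \<open>V\<close> are summable.\<close>
  define E where "E k = a k * b k * F k + ?q (z k - p) / 2" for k
  define w where "w k = (1 - d) * (a k * F (Suc k)) + (\<gamma>\<^sub>1 - 1 / 2) * V k" for k
  have E_step: "E (Suc k) + w k \<le> E k + 0" for k
  proof -
    have "a (Suc k) * b (Suc k) * F (Suc k) \<le> (a k * b k + d * a k) * F (Suc k)"
      using A F by (rule mult_right_mono)
    moreover have "a k * b k * F (Suc k) + ?q (z (Suc k) - p) / 2
        + a k * F (Suc k) + a k * (c k - a k / 2) * ?q (v k) \<le> E k"
      unfolding E_def z_Suc by (rule anchored_energy_step[OF L z sub_p sub_x a b0])
    moreover note dissipation[of k]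
    ultimately show ?thesis unfolding E_def[of "Suc k"] w_def by (simp add: algebra_simps)
  qed
  have sw: "summable w"
  proof (rule perturbed_descent(1)[where p = "\<lambda>_. 0" and e = E])
    show "0 \<le> E n" for n unfolding E_def using a b0 F q0 by simp
    show "0 \<le> w n" for n unfolding w_def using a F V0 d \<gamma>\<^sub>1 by simp
  qed (use E_step in simp_all)
  have "summable (\<lambda>k. (1 - d) * (a k * F (Suc k)))"
    by (rule summable_comparison_test'[OF sw, of 0])
       (use a F V0 d \<gamma>\<^sub>1 in \<open>simp add: w_def\<close>)
  then have saF: "summable (\<lambda>k. a k * F (Suc k))"
    using d by (subst (asm) summable_cmult_iff) auto
  have "summable (\<lambda>k. (\<gamma>\<^sub>1 - 1 / 2) * V k)"
    by (rule summable_comparison_test'[OF sw, of 0])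
       (use a F V0 d \<gamma>\<^sub>1 in \<open>simp add: w_def\<close>)
  then have sV: "summable V"
    using \<gamma>\<^sub>1 by (subst (asm) summable_cmult_iff) auto

  \<comment> \<open>The momentum energy converges, and its dissipation \<open>b D\<close> is summable.\<close>
  define G where "G k = (a k * b k + c k) * F k + ?q (z k - x k) / 2" for k
  have G0: "0 \<le> G k" for k unfolding G_def using a b0 c0 F q0 by simp
  have coeff: "(a (Suc k) * b (Suc k) + c (Suc k)) * F (Suc k)
      \<le> (a k * b k + c k) * F (Suc k) + (d + M) * (a k * F (Suc k))" for k
    using mult_right_mono[OF add_mono[OF A[of k] c[of k]] F[of "Suc k"]]
    by (simp add: algebra_simps)
  have G_step: "G (Suc k) + b k * D k \<le> G k + (d + M) * (a k * F (Suc k))" for k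
  proof -
    have "(a k * b k + c k) * F (Suc k) + ?q (z (Suc k) - x (Suc k)) / 2
        + a k * (c k - a k / 2) * ?q (v k) + (b k + 1 / 2) * D k \<le> G k"
      unfolding G_def D_def z_Suc
      by (rule momentum_energy_step[OF L z sub_x]) (simp add: a b0 c0)
    moreover have "0 \<le> (\<gamma>\<^sub>1 - 1 / 2) * V k" using \<gamma>\<^sub>1 V0 by simp
    moreover have "b k * D k \<le> (b k + 1 / 2) * D k" by (simp add: D_def q0 mult_right_mono)
    moreover note dissipation[of k] coeff[of k]
    ultimately show ?thesis unfolding G_def[of "Suc k"] by linarith
  qed
  have bD0: "0 \<le> b n * D n" for n by (simp add: D_def q0 b0)
  have sp: "summable (\<lambda>k. (d + M) * (a k * F (Suc k)))"
    by (rule summable_mult[OF saF])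
  have p0: "0 \<le> (d + M) * (a n * F (Suc n))" for n using a F d M by simp
  note descent = perturbed_descent[OF G0 bD0 p0 sp G_step]
  have sD: "summable (\<lambda>k. b k * D k)" and G_conv: "convergent G"
    by (rule descent)+

  \<comment> \<open>\<open>C\<close> is chosen so that \<open>\<bar>c k - a k\<bar> \<le> C * a k\<close>, using \<open>0 \<le> c k \<le> \<gamma>\<^sub>2 * a k\<close>.\<close>
  define C where "C = \<gamma>\<^sub>2 + 1"
  have u_bound: "?q (z (Suc k) - x (Suc k)) / 2 * (1 / b k) \<le> b k * D k + C\<^sup>2 * V k" for k
  proof -
    have "\<bar>c k - a k\<bar> \<le> C * a k"
      using c0[of k] a[of k] \<gamma>\<^sub>2(1)[of k] \<gamma>\<^sub>2(2) mult_nonneg_nonneg[of \<gamma>\<^sub>2 "a k"]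
      unfolding C_def by (simp add: algebra_simps abs_le_iff)
    then have "(c k - a k)\<^sup>2 \<le> (C * a k)\<^sup>2" by (rule abs_le_square_iff[THEN iffD1, OF order_trans]) simp
    then have "(c k - a k)\<^sup>2 * ?q (v k) \<le> C\<^sup>2 * V k"
      unfolding V_def by (simp add: mult_right_mono q0 power_mult_distrib flip: mult.assoc)
    moreover have "z (Suc k) - x (Suc k) = b k *\<^sub>R (x (Suc k) - x k) + (c k - a k) *\<^sub>R v k"
      unfolding z_Suc by (simp add: z algebra_simps)
    then have "?q (z (Suc k) - x (Suc k)) / 2 \<le> (b k)\<^sup>2 * D k + (c k - a k)\<^sup>2 * ?q (v k)"
      using quadratic_form_add_le[OF L, of "b k *\<^sub>R (x (Suc k) - x k)" "(c k - a k) *\<^sub>R v k"]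
      by (simp add: positive_definite_operator_simps(3)[OF L] D_def power2_eq_square mult_ac)
    ultimately have "?q (z (Suc k) - x (Suc k)) / 2 \<le> (b k)\<^sup>2 * D k + C\<^sup>2 * V k" by linarith
    then have "?q (z (Suc k) - x (Suc k)) / 2 * (1 / b k)
        \<le> ((b k)\<^sup>2 * D k + C\<^sup>2 * V k) * (1 / b k)"
      using b0 by (intro mult_right_mono) auto
    also have "\<dots> = b k * D k + C\<^sup>2 * V k * (1 / b k)"
      using b[of k] by (simp add: power2_eq_square field_simps)
    also have "C\<^sup>2 * V k * (1 / b k) \<le> C\<^sup>2 * V k * 1"
      using b[of k] V0 by (intro mult_left_mono) auto
    finally show ?thesis by simp
  qed
  have gap_bound: "(a (Suc k) * b (Suc k) + c (Suc k)) * F (Suc k) * (1 / b k)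
      \<le> (1 + \<gamma>\<^sub>2 + d + M) * (a k * F (Suc k))" for k
  proof -
    have "c k * F (Suc k) \<le> \<gamma>\<^sub>2 * a k * F (Suc k)"
      using \<gamma>\<^sub>2(1) F by (rule mult_right_mono)
    then have "(a (Suc k) * b (Suc k) + c (Suc k)) * F (Suc k)
        \<le> b k * (a k * F (Suc k)) + (\<gamma>\<^sub>2 + d + M) * (a k * F (Suc k))"
      using coeff[of k] by (simp add: algebra_simps)
    also have "\<dots> \<le> b k * (a k * F (Suc k)) + b k * ((\<gamma>\<^sub>2 + d + M) * (a k * F (Suc k)))"
      using mult_right_mono[OF b[of k], of "(\<gamma>\<^sub>2 + d + M) * (a k * F (Suc k))"]
        \<gamma>\<^sub>2(2) d M a F by simp
    also have "\<dots> = (1 + \<gamma>\<^sub>2 + d + M) * (a k * F (Suc k)) * b k"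
      by (simp add: algebra_simps)
    finally show ?thesis using b[of k] by (simp add: divide_le_eq)
  qed
  have "summable (\<lambda>k. G (Suc k) * (1 / b k))"
  proof (rule summable_comparison_test'[where N = 0])
    show "summable (\<lambda>k. (1 + \<gamma>\<^sub>2 + d + M) * (a k * F (Suc k)) + (b k * D k + C\<^sup>2 * V k))"
      using saF sD sV by (intro summable_add summable_mult)
    show "norm (G (Suc n) * (1 / b n))
        \<le> (1 + \<gamma>\<^sub>2 + d + M) * (a n * F (Suc n)) + (b n * D n + C\<^sup>2 * V n)" for n
    proof -
      have "norm (G (Suc n) * (1 / b n)) = G (Suc n) * (1 / b n)"
        using G0[of "Suc n"] b0[of n] by simp
      then show ?thesis
        using gap_bound[of n] u_bound[of n] unfolding G_def distrib_right by linarith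
    qed
  qed
  then have "G \<longlonglongrightarrow> 0"
    using convergent_summable_weight_tendsto_zero[OF G_conv G0 _ nb] b0 by simp
  then show ?thesis
  proof (rule tendsto_sandwich[OF _ _ tendsto_const, rotated 2])
    show "\<forall>\<^sub>F k in sequentially. 0 \<le> a k * b k * F k"
      using a b0 F by simp
    show "\<forall>\<^sub>F k in sequentially. a k * b k * F k \<le> G k"
      unfolding G_def using c0 F q0 by (simp add: distrib_right)
  qed
qed

theorem theorem6:
  fixes f :: "'a::{real_inner, complete_space} \<Rightarrow> ereal"
    and L :: "'a \<Rightarrow> 'a"
    and a b c A :: "nat \<Rightarrow> real"
    and x xt z :: "nat \<Rightarrow> 'a"
    and d \<beta> \<gamma>\<^sub>1 \<gamma>\<^sub>2 :: real
    and K :: nat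
  assumes "f \<in> Gamma_0"
    and "minimizers f \<noteq> {}"
    and "positive_definite_operator L"
    and "\<And>k. k \<ge> 1 \<Longrightarrow> a k > 0 \<and> b k > 0 \<and> c k > 0"
    and "a 0 \<ge> 0" and "b 0 \<ge> 0" and "c 0 > 0"
    and "symplectic_proximal_point f L a b c x xt z"
    and "\<And>k. A k = a k * b k"
    and "0 < d" and "d < 1"
    and "\<And>k. 0 \<le> A (k + 1) - A k \<and> A (k + 1) - A k \<le> d * a k"
    and "(SUP k\<in>{1..}. ereal ((c (k + 1) - c k) / a k)) < \<infinity>"
    and "(\<lambda>k. real k / b k) \<longlonglongrightarrow> \<beta>" and "1 < \<beta>"
    and "\<gamma>\<^sub>1 > 1 / 2" and "\<gamma>\<^sub>2 > 0"
    and "\<And>k. k \<ge> K \<Longrightarrow> \<gamma>\<^sub>1 * a k \<le> c k \<and> c k \<le> \<gamma>\<^sub>2 * a k"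
  shows "(\<lambda>k. ereal (A k) * (f (x k) - (INF y. f y))) \<longlonglongrightarrow> 0"
proof -
  note f = assms(1) and L = assms(3) and pos = assms(4) and step = assms(8) and A = assms(9)
  obtain p where "p \<in> minimizers f" using assms(2) by blast
  then have p: "f p \<le> f y" for y by (simp add: minimizers_iff)
  have x_min: "x (Suc k) \<in> minimizers
      (\<lambda>y. f y + ereal ((b k + 1) / c k / 2 * (weighted_norm L (y - xt (Suc k)))\<^sup>2))" for k
  proof -
    have "(b k + 1) / c k / 2 = (b k + 1) / (2 * c k)" by simp
    then show ?thesis using step unfolding symplectic_proximal_point_def by metis
  qed
  have fx_fin: "\<bar>f (x k)\<bar> \<noteq> \<infinity>" if "1 \<le> k" for k
    using prox_point_finite[OF f x_min[of "k - 1"]] that by simp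
  have "f p \<noteq> -\<infinity>" using f by (simp add: Gamma_0_def)
  moreover have "f p \<noteq> \<infinity>" using p[of "x 1"] fx_fin[of 1] by auto
  ultimately obtain m where m: "f p = ereal m" by (cases "f p") auto
  define F where "F k = real_of_ereal (f (x k)) - m" for k
  have fx: "f (x k) = ereal (F k + m)" if "1 \<le> k" for k
    using fx_fin[OF that] by (simp add: F_def ereal_real')
  have F0: "0 \<le> F k" if "1 \<le> k" for k
    using p[of "x k"] by (simp add: m fx[OF that])
  have INF: "(INF y. f y) = ereal m"
    using p by (intro antisym INF_greatest INF_lower2[of p]) (auto simp: m)

  \<comment> \<open>\<open>L (v k)\<close> is the subgradient of \<open>f\<close> at \<open>x (k + 1)\<close> given by the proximal step.\<close>
  define v where "v k = ((b k + 1) / c k) *\<^sub>R (xt (Suc k) - x (Suc k))" for k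
  have c_pos: "0 < c k" for k using pos[of k] assms(7) by (cases "k = 0") auto
  have b0: "0 \<le> b k" for k using pos[of k] assms(6) by (cases "k = 0") auto
  have z: "z k = x (Suc k) + b k *\<^sub>R (x (Suc k) - x k) + c k *\<^sub>R v k" for k
  proof -
    have "xt (Suc k) = (1 / (b k + 1)) *\<^sub>R (z k + b k *\<^sub>R x k)"
      using step by (simp add: symplectic_proximal_point_def scaleR_add_right)
    then have "(b k + 1) *\<^sub>R xt (Suc k) = z k + b k *\<^sub>R x k"
      using b0[of k] by simp
    moreover have "c k *\<^sub>R v k = (b k + 1) *\<^sub>R xt (Suc k) - (b k + 1) *\<^sub>R x (Suc k)"
      using c_pos[of k] by (simp add: v_def scaleR_diff_right)
    ultimately show ?thesis by (simp add: algebra_simps)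
  qed
  have z_Suc: "z (Suc k) = z k - a k *\<^sub>R v k" for k
  proof -
    have "z (Suc k) = z k + (a k * (b k + 1) / c k) *\<^sub>R (x (Suc k) - xt (Suc k))"
      using step by (simp add: symplectic_proximal_point_def)
    then show ?thesis by (simp add: v_def scaleR_diff_right)
  qed
  have sub: "F (Suc k) + m - s \<le> inner (L (v k)) (x (Suc k) - y)" if "f y = ereal s" for k y s
    unfolding v_def
    by (rule prox_subgradient[OF f L _ x_min fx that]) (use b0[of k] c_pos[of k] in auto)

  obtain M where M: "0 \<le> M" "\<And>k. 1 \<le> k \<Longrightarrow> c (Suc k) \<le> c k + M * a k"
  proof -
    let ?S = "SUP k\<in>{1..}. ereal ((c (k + 1) - c k) / a k)"
    have S: "ereal ((c (k + 1) - c k) / a k) \<le> ?S" if "1 \<le> k" for k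
      using that by (intro SUP_upper) auto
    obtain B where B: "?S = ereal B"
      using assms(13) S[of 1] by (cases ?S) auto
    have "c (Suc k) \<le> c k + \<bar>B\<bar> * a k" if "1 \<le> k" for k
    proof -
      have "(c (k + 1) - c k) / a k \<le> \<bar>B\<bar>" using S[OF that] unfolding B by simp
      then show ?thesis using pos[OF that] by (simp add: divide_le_eq)
    qed
    then show thesis using that[of "\<bar>B\<bar>"] by auto
  qed

  obtain N0 where N0: "1 \<le> b k" if "N0 \<le> k" for k
    using linear_growth_ge_one[OF _ assms(14)] pos by (auto simp: eventually_sequentially)
  \<comment> \<open>From \<open>N\<close> on, the asymptotic bounds hold; moreover \<open>N \<ge> 1\<close> skips the starting point,
    where \<open>f\<close> may be infinite and \<open>a\<close>, \<open>b\<close> may vanish.\<close>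
  define N where "N = Suc (max K N0)"
  have N: "1 \<le> k + N" "K \<le> k + N" "N0 \<le> k + N" for k by (auto simp: N_def)
  have "(\<lambda>k. a (k + N) * b (k + N) * F (k + N)) \<longlonglongrightarrow> 0"
  proof (rule symplectic_gap_tendsto_zero[where L = L and p = p
        and a = "\<lambda>k. a (k + N)" and b = "\<lambda>k. b (k + N)" and c = "\<lambda>k. c (k + N)"
        and F = "\<lambda>k. F (k + N)" and x = "\<lambda>k. x (k + N)" and z = "\<lambda>k. z (k + N)"
        and v = "\<lambda>k. v (k + N)" and d = d and M = M and \<gamma>\<^sub>1 = \<gamma>\<^sub>1 and \<gamma>\<^sub>2 = \<gamma>\<^sub>2])
    show "z (k + N) = x (Suc k + N) + b (k + N) *\<^sub>R (x (Suc k + N) - x (k + N))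
        + c (k + N) *\<^sub>R v (k + N)" for k
      using z[of "k + N"] by simp
    show "\<not> summable (\<lambda>k. 1 / b (k + N))"
      using linear_growth_not_summable_inverse[OF assms(14)] assms(15)
      by (subst summable_iff_shift[of "\<lambda>k. 1 / b k"]) simp
    show "F (Suc k + N) \<le> inner (L (v (k + N))) (x (Suc k + N) - p)" for k
      using sub[OF m, of "k + N"] by simp
    show "F (Suc k + N) - F (k + N) \<le> inner (L (v (k + N))) (x (Suc k + N) - x (k + N))" for k
      using sub[OF fx[OF N(1)[of k]], of "k + N"] by simp
    show "a (Suc k + N) * b (Suc k + N) \<le> a (k + N) * b (k + N) + d * a (k + N)" for k
      using assms(12)[of "k + N"] by (simp add: A)
    show "0 \<le> a (k + N)" for k using pos[OF N(1), of k] by simp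
  qed (use L z_Suc F0 N0 N M assms(10,11,16,17,18) in simp_all)
  then have "(\<lambda>k. A k * F k) \<longlonglongrightarrow> 0"
    unfolding A by (rule LIMSEQ_offset)
  then have "(\<lambda>k. ereal (A k * F k)) \<longlonglongrightarrow> 0"
    by (simp add: zero_ereal_def)
  moreover have "\<forall>\<^sub>F k in sequentially.
      ereal (A k * F k) = ereal (A k) * (f (x k) - (INF y. f y))"
    using eventually_ge_at_top[of 1] by eventually_elim (simp add: fx INF)
  ultimately show ?thesis by (rule Lim_transform_eventually)
qed

end
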